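(* Let $d, N$ be positive integers. Let $\lambda\in(0,2]$, and let $p_1,\ldots,p_N$ and $q_1,\ldots,q_N$ be points of $\mathbb{E}^d$ such that $$|q_i-q_j|\leq\lambda\leq|p_i-p_j|\quad\text{for all } i,j\in\{1,\ldots,N\},\ i\neq j.$$ If $N\geq\left(1+2d^3\right)^d$, then $$V_d\left(\bigcup_{i=1}^{N}\mathbf{B}[p_i]\right)\geq V_d\left(\bigcup_{i=1}^{N}\mathbf{B}[q_i]\right).$$
   Context: $\mathbb{E}^d$ is $d$-dimensional Euclidean space with Euclidean norm $|\cdot|$. $\mathbf{B}[p]:=\{x\in\mathbb{E}^d : |p-x|\leq 1\}$ is the closed unit ball centered at $p$. $V_d$ denotes $d$-dimensional volume (Lebesgue measure). *)

theory Defs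
  imports "HOL-Analysis.Analysis"
begin

end

theory Submission
  imports Defs
begin

text \<open>
  Write \<open>\<kappa>\<close> for the volume of the unit ball and \<open>d\<close> for the dimension. The centres \<open>q i\<close> all
  lie within \<open>\<lambda>\<close> of \<open>q 1\<close>, so the balls around them lie in one ball of radius \<open>1 + \<lambda>\<close> and their
  union has volume at most \<open>\<kappa> (1 + \<lambda>)\<^sup>d\<close>. The balls of radius \<open>\<lambda>/2\<close> around the \<open>p i\<close> form a
  packing, and there are so many of them that this crude bound can be beaten. Where the packing
  itself is voluminous it does so alone; where it is not, it forces two centres far apart.

  \<^item> If \<open>(d\<^sup>3 - 1/2) \<lambda> \<ge> 1\<close>, then \<open>(d\<^sup>3 + 1/2) \<lambda> \<ge> 1 + \<lambda>\<close>. The packing lies in the union of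
    the unit balls, as \<open>\<lambda>/2 \<le> 1\<close>, and has volume at least \<open>\<kappa> ((d\<^sup>3 + 1/2) \<lambda>)\<^sup>d\<close>
    (measure_Union_separated_balls).

  \<^item> If \<open>(d\<^sup>3 - 1/2) \<lambda> < 1\<close> and \<open>d \<ge> 2\<close>, the packing does not fit into a ball around \<open>p 1\<close> of
    radius less than \<open>(d\<^sup>3 + 1/2) \<lambda>\<close> (separated_balls_in_ball), so some \<open>p i\<close> has distance
    \<open>D \<ge> d\<^sup>3 \<lambda>\<close> from \<open>p 1\<close>. The two unit balls around \<open>p 1\<close> and \<open>p i\<close> already have a union of
    volume at least \<open>\<kappa> (1 + D / (2 + D))\<close> (measure_unit_cball_diff_ge). As \<open>\<lambda>\<close> tends to \<open>0\<close> this
    excess over \<open>\<kappa>\<close> is at least about \<open>\<kappa> d\<^sup>3 \<lambda> / 2\<close>, while \<open>\<kappa> (1 + \<lambda>)\<^sup>d - \<kappa>\<close> is about \<open>\<kappa> d \<lambda>\<close>; since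
    \<open>d\<^sup>2 / 2 \<ge> 2\<close> there is room to spare, enough for the whole range of \<open>\<lambda>\<close>
    (ball_growth_le_crescent).

  \<^item> On the line there is no such room, and the first bound is sharpened: the \<open>q i\<close> lie within
    \<open>\<lambda>/2\<close> of a common point, so their balls cover at most \<open>\<kappa> (1 + \<lambda>/2)\<close>. Two unit balls with
    centres at distance at least \<open>\<lambda>\<close> cover that much, because a ball of radius \<open>\<lambda>/2\<close> fits into
    one of them outside the other (cball_beyond).
\<close>

section \<open>Packings\<close>

lemma lmeasurable_UN_cball:
  "finite I \<Longrightarrow> (\<Union>i\<in>I. cball (c i) r) \<in> lmeasurable"
  by (intro fmeasurable.finite_UN) auto

lemma measure_Union_separated_balls:
  fixes p :: "'i \<Rightarrow> 'a::euclidean_space"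
  assumes "finite I" "0 \<le> r"
    and "\<And>i j. i \<in> I \<Longrightarrow> j \<in> I \<Longrightarrow> i \<noteq> j \<Longrightarrow> 2 * r \<le> dist (p i) (p j)"
  shows "measure lebesgue (\<Union>i\<in>I. ball (p i) r)
       = card I * (unit_ball_vol (DIM('a)) * r ^ DIM('a))"
proof -
  have "ball (p i) r \<inter> ball (p j) r = {}" if "i \<in> I" "j \<in> I" "i \<noteq> j" for i j
    using assms(3)[OF that] by (intro disjoint_ballI) simp
  then have "pairwise (\<lambda>i j. disjnt (ball (p i) r) (ball (p j) r)) I"
    by (auto simp: pairwise_def disjnt_def)
  then show ?thesis
    using assms by (subst measure_UNION') (auto simp: content_ball)
qed

text \<open>
  The packing bound: the volume of disjoint balls in a large ball does not exceed the volume of it.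
\<close>

lemma separated_balls_in_ball:
  fixes p :: "'i \<Rightarrow> 'a::euclidean_space" and r R :: real
  assumes "finite I" "0 \<le> r" "0 \<le> R"
    and "\<And>i j. i \<in> I \<Longrightarrow> j \<in> I \<Longrightarrow> i \<noteq> j \<Longrightarrow> 2 * r \<le> dist (p i) (p j)"
    and near: "\<And>i. i \<in> I \<Longrightarrow> dist c (p i) + r \<le> R"
  shows "card I * r ^ DIM('a) \<le> R ^ DIM('a)"
proof -
  have "(\<Union>i\<in>I. ball (p i) r) \<subseteq> ball c R"
  proof clarify
    fix x i assume "i \<in> I" "x \<in> ball (p i) r"
    with near[of i] dist_triangle[of c x "p i"] show "x \<in> ball c R" by simp
  qed
  then have "measure lebesgue (\<Union>i\<in>I. ball (p i) r) \<le> measure lebesgue (ball c R)"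
    using assms(1) by (intro measure_mono_fmeasurable) auto
  then have "unit_ball_vol (DIM('a)) * (card I * r ^ DIM('a))
           \<le> unit_ball_vol (DIM('a)) * R ^ DIM('a)"
    using assms by (simp add: measure_Union_separated_balls content_ball mult.left_commute)
  then show ?thesis by simp
qed

section \<open>How much a translate sticks out\<close>

text \<open>
  A set that has left itself after \<open>k\<close> translations by \<open>w\<close> must have shed a fixed share of its
  volume at each of them: the \<open>j\<close>-th translate exceeds the previous one by a translate of
  \<open>(w + S) - S\<close>, and \<open>k\<close> of these excesses together cover the last translate, which is disjoint
  from \<open>S\<close>.
\<close>

lemma measure_le_translation_diff:
  fixes S :: "'a::euclidean_space set"
  assumes S: "S \<in> lmeasurable" and disj: "S \<inter> (+) (real k *\<^sub>R w) ` S = {}"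
  shows "measure lebesgue S \<le> k * measure lebesgue ((+) w ` S - S)"
proof -
  define T where "T j = (+) (real j *\<^sub>R w) ` S" for j :: nat
  have T: "T j \<in> lmeasurable" for j
    unfolding T_def using S by (rule measurable_translation)
  have step: "T (Suc j) - T j = (+) (real j *\<^sub>R w) ` ((+) w ` S - S)" for j
    by (auto simp: T_def image_set_diff image_image algebra_simps)
  have "measure lebesgue (T j - S) \<le> j * measure lebesgue ((+) w ` S - S)" for j
  proof (induction j)
    case 0
    then show ?case by (simp add: T_def)
  next
    case (Suc j)
    have "measure lebesgue (T (Suc j) - S) \<le> measure lebesgue ((T (Suc j) - T j) \<union> (T j - S))"
      using S T by (intro measure_mono_fmeasurable) (auto intro: fmeasurable.Diff fmeasurableD)
    also have "\<dots> \<le> measure lebesgue (T (Suc j) - T j) + measure lebesgue (T j - S)"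
      using S T by (intro measure_Un_le) (auto intro: fmeasurableD)
    also have "measure lebesgue (T (Suc j) - T j) = measure lebesgue ((+) w ` S - S)"
      unfolding step by (rule measure_translation)
    finally show ?case using Suc.IH by (simp add: algebra_simps)
  qed
  from this[of k] have "measure lebesgue (T k - S) \<le> k * measure lebesgue ((+) w ` S - S)" .
  moreover have "T k - S = T k" using disj by (auto simp: T_def)
  ultimately show ?thesis by (simp add: T_def measure_translation)
qed

text \<open>
  For small distances \<open>D = dist a b\<close> this bound is linear in \<open>D\<close>, which is essential below. It
  avoids computing the volume of a lens: after about \<open>2 / D\<close> steps of length \<open>D\<close> a unit ball is
  disjoint from its original position.
\<close>

lemma measure_unit_cball_diff_ge:
  fixes a b :: "'a::euclidean_space"
  assumes "a \<noteq> b"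
  shows "unit_ball_vol (DIM('a)) * (dist a b / (2 + dist a b))
       \<le> measure lebesgue (cball b 1 - cball a 1)"
proof -
  define D where "D = dist a b"
  define v where "v = measure lebesgue (cball b 1 - cball a 1)"
  \<comment> \<open>the least number of steps that covers a distance of more than 2\<close>
  define k where "k = nat \<lfloor>2 / D\<rfloor> + 1"
  have D: "0 < D" using assms by (simp add: D_def)
  have k: "2 / D < k" "k \<le> 2 / D + 1"
    using D by (auto simp: k_def) linarith+
  have trans: "(+) w ` cball a 1 = cball (w + a) 1" for w :: 'a
    by (rule cball_translation[symmetric])
  have "dist a (real k *\<^sub>R (b - a) + a) = k * D"
    by (simp add: D_def dist_norm norm_minus_commute)
  moreover have "2 < k * D" using k(1) D by (simp add: field_simps)
  ultimately have "cball a 1 \<inter> cball (real k *\<^sub>R (b - a) + a) 1 = {}"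
    by (intro disjoint_cballI) simp
  then have "unit_ball_vol (DIM('a)) \<le> k * v"
    using measure_le_translation_diff[of "cball a 1" k "b - a"]
    unfolding trans by (simp add: v_def content_cball)
  also have "\<dots> \<le> (2 / D + 1) * v"
    using k(2) by (intro mult_right_mono) (auto simp: v_def)
  finally show ?thesis
    using D unfolding D_def[symmetric] v_def[symmetric] by (simp add: field_simps)
qed

text \<open>
  The small ball touches the boundary of \<open>cball b 1\<close> from inside, at the point farthest from \<open>a\<close>.
\<close>

lemma cball_beyond:
  fixes a b :: "'a::euclidean_space"
  assumes "a \<noteq> b" "0 \<le> r" "r \<le> 1" "2 * r \<le> dist a b"
  obtains c where "ball c r \<subseteq> cball b 1 - cball a 1"
proof -
  define D where "D = dist a b"
  define c where "c = b + ((1 - r) / D) *\<^sub>R (b - a)"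
  have D: "0 < D" using assms by (simp add: D_def)
  have "dist b c = 1 - r"
    using D assms by (simp add: c_def dist_norm D_def norm_minus_commute)
  moreover have "c - a = (1 + (1 - r) / D) *\<^sub>R (b - a)"
    by (simp add: c_def algebra_simps)
  then have "dist c a = \<bar>1 + (1 - r) / D\<bar> * D"
    by (simp add: dist_norm D_def norm_minus_commute)
  then have "dist c a = D + (1 - r)"
    using D assms(3) by (simp add: distrib_right)
  ultimately have "ball c r \<subseteq> cball b 1 - cball a 1"
  proof (intro subsetI)
    fix x assume x: "x \<in> ball c r"
    have "dist b x < 1"
      using x dist_triangle[of b x c] \<open>dist b c = 1 - r\<close> by simp
    moreover have "1 < dist a x"
      using x dist_triangle2[of c a x] \<open>dist c a = D + (1 - r)\<close> assms(4)
      by (simp add: D_def)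
    ultimately show "x \<in> cball b 1 - cball a 1" by simp
  qed
  then show ?thesis using that by blast
qed

section \<open>Comparison of the growth rates\<close>

text \<open>
  The left-hand side is the volume of a ball of radius \<open>1 + lam\<close> and the right-hand side is the
  lower bound for the union of two unit balls at distance \<open>D\<close>, both in units of the volume of a
  unit ball. Bernoulli's inequality applied to \<open>1 / (1 + lam)\<close> gives
  \<open>(1 + lam) ^ d \<le> (1 + lam) / (1 + lam - d * lam)\<close>. With \<open>x = d\<^sup>3 * lam\<close>, and since
  \<open>D / (2 + D)\<close> increases with \<open>D\<close>, it then suffices that
  \<open>(2 * d - 1) * x \<le> d\<^sup>3 - 2 * d\<close>. The upper bound on \<open>lam\<close> keeps \<open>x\<close> at most \<open>16/15\<close>, and there
  this holds for all \<open>d \<ge> 2\<close>.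
\<close>

lemma ball_growth_le_crescent:
  fixes lam D :: real
  assumes d: "2 \<le> d" and "0 < lam" and small: "(real d ^ 3 - 1 / 2) * lam < 1"
    and D: "real d ^ 3 * lam \<le> D"
  shows "(1 + lam) ^ d \<le> 1 + D / (2 + D)"
proof -
  define x where "x = real d ^ 3 * lam"
  have d3: "8 \<le> real d ^ 3" using power_mono[of 2 "real d" 3] d by simp
  have x0: "0 < x" using d \<open>0 < lam\<close> by (simp add: x_def)
  have "(15 / 2) * lam \<le> (real d ^ 3 - 1 / 2) * lam"
    using d3 \<open>0 < lam\<close> by (intro mult_right_mono) auto
  then have lam: "lam < 2 / 15" using small by simp
  have x: "x \<le> 16 / 15" using small lam by (simp add: x_def algebra_simps)
  have "4 * (real d * lam) \<le> real d ^ 2 * (real d * lam)"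
    using power_mono[of 2 "real d" 2] d \<open>0 < lam\<close> by (intro mult_right_mono) auto
  also have "\<dots> = x" by (simp add: x_def power2_eq_square power3_eq_cube)
  finally have dlam: "real d * lam \<le> 4 / 15" using x by simp
  then have pos: "0 < 1 + lam - d * lam" using \<open>0 < lam\<close> by linarith
  have key: "(2 * real d - 1) * x \<le> real d ^ 3 - 2 * real d"
  proof -
    have "(2 * real d - 1) * x \<le> (2 * real d - 1) * (16 / 15)"
      using x d by (intro mult_left_mono) auto
    also have "\<dots> \<le> 10 * real d - 16"
      using d by simp
    also have "\<dots> \<le> real d ^ 3 - 2 * real d"
    proof -
      \<comment> \<open>the convex \<open>d ^ 3\<close> lies above its tangent at 2: \<open>12 * d - 16 \<le> d ^ 3\<close>\<close>
      have "0 \<le> (real d - 2)\<^sup>2 * (real d + 4)" by simp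
      then show ?thesis by (simp add: power2_eq_square power3_eq_cube algebra_simps)
    qed
    finally show ?thesis .
  qed
  have "1 + real d * (- (lam / (1 + lam))) \<le> (1 + (- (lam / (1 + lam)))) ^ d"
    using \<open>0 < lam\<close> by (intro Bernoulli_inequality) (simp add: field_simps)
  also have "1 + (- (lam / (1 + lam))) = 1 / (1 + lam)"
    using \<open>0 < lam\<close> by (simp add: field_simps)
  also have "1 + real d * (- (lam / (1 + lam))) = (1 + lam - d * lam) / (1 + lam)"
    using \<open>0 < lam\<close> by (simp add: field_simps)
  finally have "(1 + lam) ^ d \<le> (1 + lam) / (1 + lam - d * lam)"
    using \<open>0 < lam\<close> pos by (simp add: field_simps)
  also have "\<dots> \<le> 1 + x / (2 + x)"
  proof -
    have "0 \<le> lam * (real d ^ 3 - 2 * real d - (2 * real d - 1) * x)"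
      using key \<open>0 < lam\<close> by simp
    also have "\<dots> = (2 + 2 * x) * (1 + lam - d * lam) - (1 + lam) * (2 + x)"
      by (simp add: x_def algebra_simps)
    finally have "(1 + lam) * (2 + x) \<le> (2 + 2 * x) * (1 + lam - d * lam)" by simp
    then have "(1 + lam) / (1 + lam - d * lam) \<le> (2 + 2 * x) / (2 + x)"
      using pos x0 by (simp add: field_simps)
    also have "\<dots> = 1 + x / (2 + x)" using x0 by (simp add: field_simps)
    finally show ?thesis .
  qed
  also have "x / (2 + x) \<le> D / (2 + D)"
    using D x0 unfolding x_def[symmetric] by (simp add: field_simps)
  finally show ?thesis by simp
qed

section \<open>Bounds for unions of balls\<close>

text \<open>
  On the line, a set of diameter at most \<open>s\<close> lies in the interval of length \<open>s\<close> that begins at its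
  least point; \<open>c\<close> is the midpoint of that interval. In higher dimensions radius \<open>s / 2\<close> is not
  enough, as an equilateral triangle shows.
\<close>

lemma cball_of_diameter_line:
  fixes q :: "'i \<Rightarrow> 'a::euclidean_space"
  assumes "DIM('a) = 1" "finite I"
    and q: "\<And>i j. i \<in> I \<Longrightarrow> j \<in> I \<Longrightarrow> dist (q i) (q j) \<le> s"
  obtains c where "\<And>i. i \<in> I \<Longrightarrow> dist c (q i) \<le> s / 2"
proof (cases "I = {}")
  case True
  then show ?thesis using that by blast
next
  case False
  obtain b :: 'a where b: "Basis = {b}" using assms(1) by (auto simp: card_1_singleton_iff)
  have n: "norm x = \<bar>x \<bullet> b\<bar>" for x :: 'a
    using euclidean_representation[of x] b norm_Basis[of b]
    by (metis finite.intros(1) insertI1 norm_scaleR mult.right_neutral sum.empty sum.insert add.right_neutral empty_iff)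
  define m where "m = Min ((\<lambda>i. q i \<bullet> b) ` I)"
  have "m \<in> (\<lambda>i. q i \<bullet> b) ` I" unfolding m_def using assms(2) False by (intro Min_in) auto
  then obtain k where k: "k \<in> I" "m = q k \<bullet> b" by blast
  have bb: "b \<bullet> b = 1" using b by (metis inner_Basis insertI1)
  have "dist ((m + s / 2) *\<^sub>R b) (q i) \<le> s / 2" if "i \<in> I" for i
  proof -
    have "m \<le> q i \<bullet> b" unfolding m_def using assms(2) that by simp
    moreover have "\<bar>q i \<bullet> b - m\<bar> \<le> s"
      using q[OF that k(1)] k(2) by (simp add: dist_norm n inner_diff_left)
    ultimately have "\<bar>m + s / 2 - q i \<bullet> b\<bar> \<le> s / 2" by linarith
    then show ?thesis by (simp add: dist_norm n inner_diff_left bb)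
  qed
  then show ?thesis using that by blast
qed

lemma measure_Union_cball_le:
  fixes q :: "'i \<Rightarrow> 'a::euclidean_space"
  assumes "finite I" "0 \<le> r" "0 \<le> s" and q: "\<And>i. i \<in> I \<Longrightarrow> dist c (q i) \<le> s"
  shows "measure lebesgue (\<Union>i\<in>I. cball (q i) r) \<le> unit_ball_vol (DIM('a)) * (r + s) ^ DIM('a)"
proof -
  have "(\<Union>i\<in>I. cball (q i) r) \<subseteq> cball c (r + s)"
  proof clarify
    fix x i assume "i \<in> I" "x \<in> cball (q i) r"
    with q[of i] dist_triangle[of c x "q i"] show "x \<in> cball c (r + s)" by simp
  qed
  then have "measure lebesgue (\<Union>i\<in>I. cball (q i) r) \<le> measure lebesgue (cball c (r + s))"
    using assms(1) by (intro measure_mono_fmeasurable) auto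
  then show ?thesis using assms by (simp add: content_cball)
qed

lemma measure_Union_cball_ge:
  fixes p :: "'i \<Rightarrow> 'a::euclidean_space"
  assumes "finite I" "i \<in> I" "j \<in> I" "T \<subseteq> cball (p j) 1 - cball (p i) 1" "T \<in> sets lebesgue"
  shows "unit_ball_vol (DIM('a)) + measure lebesgue T
       \<le> measure lebesgue (\<Union>i\<in>I. cball (p i) 1)"
proof -
  have T: "T \<in> lmeasurable"
    using assms(4,5) by (intro fmeasurableI2[OF lmeasurable_cball[of "p j" 1]]) auto
  have "unit_ball_vol (DIM('a)) + measure lebesgue T
      = measure lebesgue (cball (p i) 1) + measure lebesgue T"
    by (simp add: content_cball)
  also have "\<dots> = measure lebesgue (cball (p i) 1 \<union> T)"
    using measure_Un2[OF lmeasurable_cball T, of "p i" 1] assms(4)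
    by (simp add: Diff_triv disjoint_iff subset_iff)
  also have "\<dots> \<le> measure lebesgue (\<Union>i\<in>I. cball (p i) 1)"
    using assms T by (intro measure_mono_fmeasurable lmeasurable_UN_cball) (auto intro: fmeasurableD)
  finally show ?thesis .
qed

section \<open>Uniform contractions of many balls\<close>

theorem theorem1p2:
  fixes p q :: "nat \<Rightarrow> 'a::euclidean_space" and N :: nat and lam :: real
  assumes "0 < N"
    and "0 < lam" and "lam \<le> 2"
    and "\<And>i j. i \<in> {1..N} \<Longrightarrow> j \<in> {1..N} \<Longrightarrow> i \<noteq> j \<Longrightarrow>
           norm (q i - q j) \<le> lam \<and> lam \<le> norm (p i - p j)"
    and "N \<ge> (1 + 2 * DIM('a) ^ 3) ^ DIM('a)"
  shows "measure lebesgue (\<Union>i\<in>{1..N}. cball (p i) 1) \<ge>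
         measure lebesgue (\<Union>i\<in>{1..N}. cball (q i) 1)"
proof -
  let ?\<kappa> = "unit_ball_vol (DIM('a))"
  let ?P = "\<Union>i\<in>{1..N}. cball (p i) 1"
  let ?Q = "\<Union>i\<in>{1..N}. cball (q i) 1"
  define d where "d = DIM('a)"
  have d1: "1 \<le> d" unfolding d_def by (simp add: Suc_leI)
  have one: "1 \<in> {1..N}" using assms(1) by simp
  have q: "dist (q i) (q j) \<le> lam" if "i \<in> {1..N}" "j \<in> {1..N}" for i j
    using assms(2,4) that by (cases "i = j") (auto simp: dist_norm)
  have p: "lam \<le> dist (p i) (p j)" if "i \<in> {1..N}" "j \<in> {1..N}" "i \<noteq> j" for i j
    using assms(4) that by (auto simp: dist_norm)
  have "real ((1 + 2 * d ^ 3) ^ d) \<le> real N"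
    using assms(5) unfolding d_def of_nat_le_iff .
  then have N: "(1 + 2 * real d ^ 3) ^ d \<le> real N" by simp
  have N_scaled: "((real d ^ 3 + 1 / 2) * lam) ^ d \<le> N * (lam / 2) ^ d"
  proof -
    have "((real d ^ 3 + 1 / 2) * lam) ^ d = ((1 + 2 * real d ^ 3) * (lam / 2)) ^ d"
      by (simp add: field_simps)
    also have "\<dots> = (1 + 2 * real d ^ 3) ^ d * (lam / 2) ^ d"
      by (rule power_mult_distrib)
    also have "\<dots> \<le> N * (lam / 2) ^ d"
      using N assms(2) by (intro mult_right_mono) auto
    finally show ?thesis .
  qed
  have Q: "measure lebesgue ?Q \<le> ?\<kappa> * (1 + lam) ^ d"
    unfolding d_def using assms(2) q one by (intro measure_Union_cball_le[of _ _ _ "q 1"]) auto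
  consider "d = 1" | "1 \<le> (real d ^ 3 - 1 / 2) * lam"
    | "2 \<le> d" "(real d ^ 3 - 1 / 2) * lam < 1"
    using d1 by linarith
  then show ?thesis
  proof cases
    case 1
    then have DIM: "DIM('a) = 1" by (simp add: d_def)
    have two: "2 \<in> {1..N}" using N 1 by simp
    obtain c where "\<And>i. i \<in> {1..N} \<Longrightarrow> dist c (q i) \<le> lam / 2"
      using cball_of_diameter_line[OF DIM finite_atLeastAtMost, of 1 N q lam] q by blast
    then have "measure lebesgue ?Q \<le> ?\<kappa> * (1 + lam / 2)"
      using measure_Union_cball_le[of "{1..N}" 1 "lam / 2" c q] assms(2) by (simp add: DIM)
    moreover
    have "p 1 \<noteq> p 2" "0 \<le> lam / 2" "lam / 2 \<le> 1" "2 * (lam / 2) \<le> dist (p 1) (p 2)"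
      using p[OF one two] assms(2,3) by auto
    then obtain b where "ball b (lam / 2) \<subseteq> cball (p 2) 1 - cball (p 1) 1"
      by (rule cball_beyond)
    then have "?\<kappa> + measure lebesgue (ball b (lam / 2)) \<le> measure lebesgue ?P"
      using one two by (intro measure_Union_cball_ge[of _ 1 2]) auto
    ultimately show ?thesis
      using assms(2) by (simp add: content_ball DIM algebra_simps)
  next
    case 2
    have "(1 + lam) ^ d \<le> ((real d ^ 3 + 1 / 2) * lam) ^ d"
      using 2 assms(2) by (intro power_mono) (auto simp: algebra_simps)
    also note N_scaled
    finally have "?\<kappa> * (1 + lam) ^ d \<le> ?\<kappa> * (N * (lam / 2) ^ d)"
      by (intro mult_left_mono) auto
    also have "\<dots> = measure lebesgue (\<Union>i\<in>{1..N}. ball (p i) (lam / 2))"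
      using p assms(2) by (subst measure_Union_separated_balls) (auto simp: d_def)
    also have "\<dots> \<le> measure lebesgue ?P"
    proof (intro measure_mono_fmeasurable lmeasurable_UN_cball)
      have "ball (p i) (lam / 2) \<subseteq> cball (p i) 1" for i
        using assms(3) by auto
      then show "(\<Union>i\<in>{1..N}. ball (p i) (lam / 2)) \<subseteq> ?P" by blast
    qed auto
    finally show ?thesis using Q by linarith
  next
    case 3
    \<comment> \<open>the distance from \<open>p 1\<close> to the farthest centre\<close>
    define D where "D = Max ((\<lambda>i. dist (p 1) (p i)) ` {1..N})"
    have "D \<in> (\<lambda>i. dist (p 1) (p i)) ` {1..N}"
      unfolding D_def using assms(1) by (intro Max_in) auto
    then obtain i where i: "i \<in> {1..N}" "D = dist (p 1) (p i)" by blast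
    have near: "dist (p 1) (p j) \<le> D" if "j \<in> {1..N}" for j
      unfolding D_def using that by (intro Max_ge) auto
    have "card {1..N} * (lam / 2) ^ DIM('a) \<le> (D + lam / 2) ^ DIM('a)"
      using p near assms(2) i(2) by (intro separated_balls_in_ball[of _ _ _ p "p 1"]) auto
    then have "N * (lam / 2) ^ d \<le> (D + lam / 2) ^ d" by (simp add: d_def)
    with N_scaled have "((real d ^ 3 + 1 / 2) * lam) ^ d \<le> (D + lam / 2) ^ d" by linarith
    then have "(real d ^ 3 + 1 / 2) * lam \<le> D + lam / 2"
      using d1 assms(2) i by (subst (asm) power_mono_iff) auto
    then have D: "real d ^ 3 * lam \<le> D" by (simp add: algebra_simps)
    moreover have "0 < real d ^ 3 * lam" using d1 assms(2) by simp
    ultimately have "p 1 \<noteq> p i" using i by auto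
    have "?\<kappa> * (1 + lam) ^ d \<le> ?\<kappa> * (1 + D / (2 + D))"
      using ball_growth_le_crescent[OF 3(1) assms(2) 3(2) D] by (intro mult_left_mono) auto
    also have "\<dots> \<le> ?\<kappa> + measure lebesgue (cball (p i) 1 - cball (p 1) 1)"
      using measure_unit_cball_diff_ge[OF \<open>p 1 \<noteq> p i\<close>] i by (simp add: algebra_simps)
    also have "\<dots> \<le> measure lebesgue ?P"
      using one i by (intro measure_Union_cball_ge[of _ 1 i]) auto
    finally show ?thesis using Q by linarith
  qed
qed

end
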